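(* Let $E:\mathbb{R}^n\to\mathbb{R}^n$ be continuous and monotone, let $X^*=\{x\in\mathbb{R}^n:E(x)=0\}$, and let $x^*\in X^*$. Suppose that $E$ is continuously differentiable on an open neighborhood of $x^*$ and that the Jacobian $J_E(x^* )$ is nonsingular. Then there exist constants $\vartheta>0$ and $\delta>0$ such that $$\vartheta\,\operatorname{dist}(x,X^* )\le\|E(x)\|\qquad\text{for all }x\in B_\delta(x^* ).$$
   Context: $\|\cdot\|$ is the Euclidean norm; $\operatorname{dist}(x,C)=\inf\{\|x-y\|:y\in C\}$; $B_\delta(x^* )$ is the open ball of radius $\delta$ centered at $x^*$. Monotone means $(E(x_1)-E(x_2))^T(x_1-x_2)\ge0$ for all $x_1,x_2\in\mathbb{R}^n$; continuity and monotonicity of $E$ are standing assumptions of the paper. *)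

theory Defs
  imports "HOL-Analysis.Analysis"
begin

definition monotone_map_inner :: "(real ^ 'n \<Rightarrow> real ^ 'n) \<Rightarrow> bool" where
  "monotone_map_inner E \<longleftrightarrow> (\<forall>x y. (E x - E y) \<bullet> (x - y) \<ge> 0)"

(* Meant for open U: derivatives are taken at x in the full space, not within U. *)
definition continuously_differentiable_on :: "(real ^ 'n \<Rightarrow> real ^ 'm) \<Rightarrow> (real ^ 'n) set \<Rightarrow> bool" where
  "continuously_differentiable_on E U \<longleftrightarrow>
     (\<forall>x\<in>U. E differentiable (at x)) \<and> continuous_on U (\<lambda>x. jacobian E (at x))"

end

theory Submission
  imports Defs
begin

text \<open>The bound holds because, close to the zero \<open>xs\<close>, \<open>norm (E x)\<close> grows at least linearly in \<open>norm (x - xs)\<close>.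
  The nonsingular Jacobian is bounded below, \<open>norm (J h) \<ge> B * norm h\<close> with \<open>B > 0\<close>, and the
  first-order error \<open>E x - J (x - xs)\<close> is at most \<open>B / 2 * norm (x - xs)\<close> near \<open>xs\<close>; what
  remains of \<open>norm (E x)\<close> is at least \<open>B / 2 * norm (x - xs)\<close>
  (\<open>has_derivative_inj_imp_locally_bounded_below\<close>). Since \<open>xs\<close> is itself a zero, the distance
  from \<open>x\<close> to the solution set never exceeds \<open>norm (x - xs)\<close>.\<close>

text \<open>In finite dimension an injective linear map stretches every vector by at least a fixed
  factor \<open>B > 0\<close>, and the error of the linearization eventually costs only half of it.\<close>

lemma has_derivative_inj_imp_locally_bounded_below:
  fixes f :: "'a::euclidean_space \<Rightarrow> 'b::euclidean_space"
  assumes der: "(f has_derivative f') (at a)" and "inj f'"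
  obtains c d where "c > 0" "d > 0"
    "\<And>x. x \<in> ball a d \<Longrightarrow> c * dist x a \<le> norm (f x - f a)"
proof -
  have "linear f'"
    using der by (rule has_derivative_linear)
  then obtain B where B: "B > 0" "\<And>h. B * norm h \<le> norm (f' h)"
    using linear_inj_bounded_below_pos[of f'] \<open>inj f'\<close> by blast
  obtain d where d: "d > 0"
    "\<And>x. norm (x - a) < d \<Longrightarrow> norm (f x - f a - f' (x - a)) \<le> B / 2 * norm (x - a)"
    using der half_gt_zero[OF B(1)] unfolding has_derivative_at_alt by blast
  show ?thesis
  proof (rule that[of "B / 2" d])
    fix x assume "x \<in> ball a d"
    then have "norm (f x - f a - f' (x - a)) \<le> B / 2 * norm (x - a)"
      by (intro d(2)) (simp add: dist_norm norm_minus_commute)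
    moreover have "B * norm (x - a) \<le> norm (f' (x - a))"
      by (rule B(2))
    moreover have "norm (f' (x - a)) \<le> norm (f x - f a) + norm (f x - f a - f' (x - a))"
      using norm_triangle_sub[of "f' (x - a)" "f x - f a"] by (simp add: norm_minus_commute)
    ultimately show "B / 2 * dist x a \<le> norm (f x - f a)"
      by (simp add: dist_norm)
  qed (use B d in auto)
qed

theorem theorem2:
  fixes E :: "real ^ 'n \<Rightarrow> real ^ 'n" and X :: "(real ^ 'n) set" and xs :: "real ^ 'n"
  assumes "continuous_on UNIV E"
    and "monotone_map_inner E"
    and "X = {x. E x = 0}"
    and "xs \<in> X"
    and "\<exists>U. open U \<and> xs \<in> U \<and> continuously_differentiable_on E U"
    and "invertible (jacobian E (at xs))"
  shows "\<exists>\<theta>>0. \<exists>\<delta>>0. \<forall>x\<in>ball xs \<delta>. \<theta> * infdist x X \<le> norm (E x)"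
proof -
  have "E differentiable (at xs)"
    using assms(5) unfolding continuously_differentiable_on_def by blast
  then have "(E has_derivative (\<lambda>h. jacobian E (at xs) *v h)) (at xs)"
    by (simp add: jacobian_works)
  moreover have "inj (\<lambda>h. jacobian E (at xs) *v h)"
    using assms(6) by (rule inj_matrix_vector_mult)
  ultimately obtain c d where c: "c > 0" and "d > 0"
    and growth: "\<And>x. x \<in> ball xs d \<Longrightarrow> c * dist x xs \<le> norm (E x - E xs)"
    by (rule has_derivative_inj_imp_locally_bounded_below) blast
  have "c * infdist x X \<le> norm (E x)" if "x \<in> ball xs d" for x
  proof -
    have "c * infdist x X \<le> c * dist x xs"
      using c infdist_le[OF assms(4)] by simp
    also have "\<dots> \<le> norm (E x)"
      using growth[OF that] assms(3,4) by simp
    finally show ?thesis .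
  qed
  with c \<open>d > 0\<close> show ?thesis
    by blast
qed

end
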